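(* Let $n,m>1$ be integers, and let $g=\gcd(n,m)$. Then $G_{n,m,2}$ is Hamiltonian if and only if $G_{n,\,m+4\cdot(4g)!\cdot n,\,2}$ is Hamiltonian.
   Context: For integers $n,m>1$, the graph $G_{n,m,2}$ (an augmented directed grid graph on a two-holed torus) is defined as follows. Its vertices are the $4nm$ cells $(i,c)$ of a grid with $2n$ rows $0\le i<2n$ (row $0$ on top) and $2m$ columns $0\le c<2m$ (column $0$ leftmost). The bijection $u$ ("up") on cells is $u(i,c)=(i-1,c)$ if $i\ge 1$, and $u(0,c)=(2n-1,(c+m)\bmod 2m)$. The bijection $r$ ("right") on cells is $r(i,c)=(i,c+1)$ if $c<2m-1$, and $r(i,2m-1)=((i+n)\bmod 2n,0)$. The directed edges are $(\alpha,u\alpha)$ and $(\alpha,r\alpha)$ for every cell $\alpha$. A directed graph is Hamiltonian if it has a directed cycle visiting every vertex exactly once. *)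

theory Defs
  imports "Graph_Theory.Graph_Theory"
begin

definition cells :: "nat \<Rightarrow> nat \<Rightarrow> (nat \<times> nat) set" where
  "cells n m = {0..<2 * n} \<times> {0..<2 * m}"

(* Cells are pairs (row, column) with row 0 on top, so moving up decreases the row.
   The two maps below are only meaningful on cells n m. *)

definition up :: "nat \<Rightarrow> nat \<Rightarrow> nat \<times> nat \<Rightarrow> nat \<times> nat" where
  "up n m = (\<lambda>(i, c). if i \<ge> 1 then (i - 1, c) else (2 * n - 1, (c + m) mod (2 * m)))"

definition right :: "nat \<Rightarrow> nat \<Rightarrow> nat \<times> nat \<Rightarrow> nat \<times> nat" where
  "right n m = (\<lambda>(i, c). if c < 2 * m - 1 then (i, c + 1) else ((i + n) mod (2 * n), 0))"

definition torus_grid :: "nat \<Rightarrow> nat \<Rightarrow> (nat \<times> nat, (nat \<times> nat) \<times> (nat \<times> nat)) pre_digraph" where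
  "torus_grid n m =
    \<lparr> verts = cells n m,
      arcs = {(\<alpha>, up n m \<alpha>) | \<alpha>. \<alpha> \<in> cells n m} \<union> {(\<alpha>, right n m \<alpha>) | \<alpha>. \<alpha> \<in> cells n m},
      tail = fst,
      head = snd \<rparr>"

(* The predicate cycle already excludes repeated vertices (apart from the common first and
   last one) and the empty walk; on a closed walk the tails of the arcs are all the vertices. *)

definition hamiltonian :: "('a, 'b) pre_digraph \<Rightarrow> bool" where
  "hamiltonian G \<longleftrightarrow> (\<exists>p. pre_digraph.cycle G p \<and> tail G ` set p = verts G)"

lemma card_cells: "card (cells n m) = 4 * n * m"
  by (simp add: cells_def card_cartesian_product)

lemma half_turn:
  "(x + k) mod (2 * k) = (if x < k then x + k else x - k)" if "x < 2 * k" for x k :: nat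
proof (cases "x < k")
  case False
  then have "x + k = (x - k) + 2 * k" using that by linarith
  then have "(x + k) mod (2 * k) = (x - k) mod (2 * k)" by (metis mod_add_self2)
  with False that show ?thesis by simp
qed simp

lemma bij_betw_up:
  assumes "n > 0" "m > 0"
  shows "bij_betw (up n m) (cells n m) (cells n m)"
proof -
  have "up n m \<alpha> \<in> cells n m" if "\<alpha> \<in> cells n m" for \<alpha>
    using that assms by (cases \<alpha>) (simp add: up_def cells_def half_turn, linarith?)
  moreover have "inj_on (up n m) (cells n m)"
  proof (rule inj_onI)
    fix \<alpha> \<beta> assume "\<alpha> \<in> cells n m" "\<beta> \<in> cells n m" "up n m \<alpha> = up n m \<beta>"
    then show "\<alpha> = \<beta>"
      by (cases \<alpha>; cases \<beta>) (simp add: up_def cells_def half_turn split: if_splits)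
  qed
  ultimately show ?thesis
    by (simp add: bij_betw_def endo_inj_surj cells_def image_subset_iff)
qed

lemma bij_betw_right:
  assumes "n > 0" "m > 0"
  shows "bij_betw (right n m) (cells n m) (cells n m)"
proof -
  have "right n m \<alpha> \<in> cells n m" if "\<alpha> \<in> cells n m" for \<alpha>
    using that assms by (cases \<alpha>) (simp add: right_def cells_def half_turn, linarith?)
  moreover have "inj_on (right n m) (cells n m)"
  proof (rule inj_onI)
    fix \<alpha> \<beta> assume "\<alpha> \<in> cells n m" "\<beta> \<in> cells n m" "right n m \<alpha> = right n m \<beta>"
    then show "\<alpha> = \<beta>"
      by (cases \<alpha>; cases \<beta>) (simp add: right_def cells_def half_turn split: if_splits; linarith)
  qed
  ultimately show ?thesis
    by (simp add: bij_betw_def endo_inj_surj cells_def image_subset_iff)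
qed

lemma wf_digraph_torus_grid:
  assumes "n > 0" "m > 0"
  shows "wf_digraph (torus_grid n m)"
  using bij_betw_up[OF assms] bij_betw_right[OF assms]
  by unfold_locales (auto simp: torus_grid_def dest: bij_betw_apply)

end

theory Submission
  imports Defs "HOL-Number_Theory.Cong"
begin

text \<open>
  A Hamiltonian cycle is a cyclic permutation \<open>f\<close> of the cells with \<open>f \<alpha> \<in> {u \<alpha>, r \<alpha>}\<close>. Stack the
  two halves of the grid into a cylinder \<open>\<int>/4n \<times> {0..<m}\<close> and use height plus column as first
  coordinate, so that both moves increase it by \<open>1\<close>. Bijectivity forces the choice between up and
  right to depend on this coordinate alone, through a set \<open>P\<close> compatible with the re-entry map from
  the last column to column \<open>0\<close>; that map only depends on \<open>m\<close> modulo \<open>4n\<close>. After \<open>4n\<close> steps inside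
  the cylinder a path has the same first coordinate and has moved right by the number \<open>p\<close> of
  residues outside \<open>P\<close>. Hence inserting \<open>p\<close> columns does not change the first-return map to the
  other columns, nor whether the permutation is cyclic. Since \<open>P\<close> is invariant under a bijection
  that is translation by \<open>- m\<close> modulo \<open>n\<close>, \<open>p\<close> is a multiple \<open>s * (n div g)\<close> with \<open>1 \<le> s \<le> 4g\<close>, so \<open>p\<close>
  divides \<open>4 * (4g)! * n\<close>.
\<close>

section \<open>Hamiltonian cycles as cyclic permutations\<close>

text \<open>Around a closed walk the heads are the tails rotated by one place, so both lists have
  the same multiset. This links \<open>cycle\<close>, which asks for distinct heads, to
  \<open>hamiltonian\<close>, which speaks of tails.\<close>

lemma (in wf_digraph) distinct_tl_awalk_verts:
  assumes "cas u p u" "p \<noteq> []"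
  shows "distinct (tl (awalk_verts u p)) \<longleftrightarrow> distinct (map (tail G) p)"
proof -
  have "map (tail G) p @ [head G (last p)] = tail G (hd p) # map (head G) p"
    using awalk_verts_conv[of u p] awalk_verts_conv'[OF assms(1)] assms(2) by simp
  moreover have "head G (last p) = u"
    using awlast_if_cas[OF assms(1)] assms(2) by (simp add: awalk_verts_conv)
  moreover have "tail G (hd p) = u"
    using assms by (simp add: cas_simp)
  ultimately have "mset (map (tail G) p @ [u]) = mset (u # map (head G) p)"
    by metis
  then have "mset (map (tail G) p) = mset (map (head G) p)"
    by simp
  then show ?thesis
    using awalk_verts_conv'[OF assms(1)] assms(2) by (metis list.sel(3) mset_eq_imp_distinct_iff)
qed

lemma (in pre_digraph) heads_subset_orbit:
  assumes "cas u p v" "\<And>e. e \<in> set p \<Longrightarrow> f (tail G e) = head G e"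
  shows "head G ` set p \<subseteq> orbit f u"
  using assms
proof (induct p arbitrary: u)
  case (Cons e es)
  then have "head G e = f u" "head G ` set es \<subseteq> orbit f (head G e)"
    by auto
  then show ?case
    by (auto intro: orbit.base orbit_subset)
qed simp

text \<open>\<open>E\<close> picks the arc that \<open>f\<close> follows out of a vertex. An
  \<open>orbit f s\<close> begins with \<open>f s\<close>, so \<open>s\<close> belongs to it only by
  returning, which the last assumption grants.\<close>

lemma (in wf_digraph) cas_funpow:
  assumes "\<And>v. v \<in> orbit f s \<Longrightarrow> tail G (E v) = v" "\<And>v. v \<in> orbit f s \<Longrightarrow> head G (E v) = f v"
    and "s \<in> orbit f s"
  shows "cas s (map (\<lambda>k. E ((f ^^ k) s)) [0..<n]) ((f ^^ n) s)"
proof (induct n)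
  case (Suc n)
  then have "awlast s (map (\<lambda>k. E ((f ^^ k) s)) [0..<n]) = (f ^^ n) s"
    by (rule awlast_if_cas)
  moreover have "(f ^^ n) s \<in> orbit f s"
    using assms(3) by (rule funpow_in_orbit)
  ultimately show ?case
    using Suc assms(1,2) by simp
qed simp

text \<open>The function read off a Hamiltonian cycle sends the tail of each of its arcs to the
  head. Arcs can then be forgotten in favour of functions on vertices.\<close>

lemma hamiltonian_iff_cyclic_on:
  assumes "wf_digraph G"
  shows "hamiltonian G \<longleftrightarrow>
    (\<exists>f. cyclic_on f (verts G) \<and> (\<forall>v\<in>verts G. \<exists>e\<in>arcs G. tail G e = v \<and> head G e = f v))"
proof -
  interpret wf_digraph G by fact
  show ?thesis
  proof
    assume "hamiltonian G"
    then obtain p u where p: "awalk u p u" "distinct (tl (awalk_verts u p))" "p \<noteq> []"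
      and cover: "tail G ` set p = verts G"
      by (auto simp: hamiltonian_def cycle_def)
    from p have cas: "cas u p u" and arcs: "set p \<subseteq> arcs G" and u: "u \<in> verts G"
      by (auto simp: awalk_def)
    have inj: "inj_on (tail G) (set p)"
      using p distinct_tl_awalk_verts[OF cas] by (simp add: distinct_map)
    define f where "f = head G \<circ> the_inv_into (set p) (tail G)"
    have f: "f (tail G e) = head G e" if "e \<in> set p" for e
      using that by (simp add: f_def the_inv_into_f_f[OF inj])
    have f_arc: "\<exists>e\<in>arcs G. tail G e = v \<and> head G e = f v" if "v \<in> verts G" for v
    proof -
      from that have "v \<in> tail G ` set p"
        by (simp add: cover)
      then obtain e where "e \<in> set p" "v = tail G e"
        by (rule imageE)
      then show ?thesis
        using f[of e] arcs by (intro bexI[of _ e]) auto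
    qed
    have "orbit f u \<subseteq> verts G"
    proof
      fix x assume "x \<in> orbit f u"
      then show "x \<in> verts G"
        by induct (use f_arc u in \<open>metis head_in_verts\<close>)+
    qed
    moreover have "verts G \<subseteq> orbit f u"
    proof -
      have "insert u (head G ` set p) = set (awalk_verts u p)"
        using awalk_verts_conv'[OF cas] p(3) cas by (auto simp: cas_simp)
      then have "verts G \<subseteq> insert u (head G ` set p)"
        using cover set_awalk_verts_cas[OF cas] by auto
      moreover have "u = head G (last p)"
        using awlast_if_cas[OF cas] p(3) by (simp add: awalk_verts_conv)
      then have "u \<in> head G ` set p"
        using p(3) by auto
      ultimately show ?thesis
        using heads_subset_orbit[OF cas f] by auto
    qed
    ultimately have "cyclic_on f (verts G)"
      using u by (auto simp: cyclic_on_def)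
    then show "\<exists>f. cyclic_on f (verts G) \<and>
        (\<forall>v\<in>verts G. \<exists>e\<in>arcs G. tail G e = v \<and> head G e = f v)"
      using f_arc by blast
  next
    assume "\<exists>f. cyclic_on f (verts G) \<and>
        (\<forall>v\<in>verts G. \<exists>e\<in>arcs G. tail G e = v \<and> head G e = f v)"
    then obtain f E where f: "cyclic_on f (verts G)"
      and E: "\<And>v. v \<in> verts G \<Longrightarrow> E v \<in> arcs G \<and> tail G (E v) = v \<and> head G (E v) = f v"
      by metis
    from f obtain s where s: "s \<in> verts G" and orb: "orbit f s = verts G"
      by (auto simp: cyclic_on_def)
    \<comment> \<open>The first positive return time is the length of the cycle: its minimality
      keeps the earlier iterates distinct.\<close>
    define n where "n = funpow_dist1 f s s"
    define p where "p = map (\<lambda>k. E ((f ^^ k) s)) [0..<n]"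
    have "(f ^^ n) s = s"
      using funpow_dist1_prop[of s f s] s orb by (simp add: n_def)
    then have cas: "cas s p s"
      using cas_funpow[of f s E n] E s orb by (simp add: p_def)
    have in_verts: "(f ^^ k) s \<in> verts G" for k
      using f s by (rule cyclic_on_funpow_in)
    have "p \<noteq> []"
      by (simp add: p_def n_def)
    have tails: "map (tail G) p = map (\<lambda>k. (f ^^ k) s) [0..<n]"
      using in_verts E by (simp add: p_def)
    have "distinct (map (tail G) p)"
      using inj_on_funpow_dist1[of s f s] s orb
      unfolding tails by (simp add: n_def distinct_map del: upt_Suc)
    then have "cycle p"
      using distinct_tl_awalk_verts[OF cas] cas s E in_verts \<open>p \<noteq> []\<close>
      by (auto simp: cycle_def awalk_def p_def)
    moreover have "tail G ` set p = verts G"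
      using orbit_conv_funpow_dist1[of s f] s orb tails
      by (metis image_set list.set_map n_def set_upt)
    ultimately show "hamiltonian G"
      by (auto simp: hamiltonian_def)
  qed
qed

section \<open>Inserting columns into a cylinder\<close>

definition cyl :: "nat \<Rightarrow> nat \<Rightarrow> (nat \<times> nat) set" where
  "cyl N M = {..<N} \<times> {..<M}"

definition cyl_up :: "nat \<Rightarrow> nat \<times> nat \<Rightarrow> nat \<times> nat" where
  "cyl_up N = (\<lambda>(w, c). ((w + 1) mod N, c))"

definition cyl_right :: "nat \<Rightarrow> (nat \<Rightarrow> nat) \<Rightarrow> nat \<Rightarrow> nat \<times> nat \<Rightarrow> nat \<times> nat" where
  "cyl_right N \<tau> M = (\<lambda>(w, c). if c + 1 < M then ((w + 1) mod N, c + 1) else (\<tau> w, 0))"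

definition cyl_step :: "nat \<Rightarrow> (nat \<Rightarrow> nat) \<Rightarrow> nat set \<Rightarrow> nat \<Rightarrow> nat \<times> nat \<Rightarrow> nat \<times> nat" where
  "cyl_step N \<tau> P M x = (if fst x \<in> P then cyl_up N x else cyl_right N \<tau> M x)"

text \<open>If \<open>\<tau> v = (w + 1) mod N\<close>, the right arc from \<open>(v, M - 1)\<close>
  and the up arc from \<open>(w, 0)\<close> end in the same cell. A permutation uses exactly one of
  them, so \<open>v\<close> and \<open>w\<close> make the same choice.\<close>

definition seam_compatible :: "nat \<Rightarrow> (nat \<Rightarrow> nat) \<Rightarrow> nat set \<Rightarrow> bool" where
  "seam_compatible N \<tau> P \<longleftrightarrow>
    (\<forall>v<N. \<forall>w<N. \<tau> v = (w + 1) mod N \<longrightarrow> (v \<in> P \<longleftrightarrow> w \<in> P))"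

lemma Suc_mod_inj:
  "Suc v mod N = Suc w mod N \<Longrightarrow> v < N \<Longrightarrow> w < N \<Longrightarrow> v = w"
  by (auto simp: mod_Suc split: if_splits)

lemma cyclic_on_bij:
  assumes "cyclic_on f S"
  shows "bij_betw f S S"
proof -
  have "f ` S \<subseteq> S"
    using cyclic_on_inI[OF assms] by blast
  moreover have "S \<subseteq> f ` S"
  proof
    fix y assume y: "y \<in> S"
    then have "y \<in> orbit f y"
      using assms by (simp add: orbit_cyclic_eq3)
    then show "y \<in> f ` S"
      by cases (use y orbit_cyclic_eq3[OF assms y] in auto)
  qed
  ultimately show ?thesis
    using finite_cyclic_on[OF assms] by (simp add: bij_betw_def eq_card_imp_inj_on subset_antisym)
qed

section \<open>Which choices between up and right give a permutation\<close>

locale cylinder =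
  fixes N :: nat and \<tau> :: "nat \<Rightarrow> nat"
  assumes N: "N > 0" and \<tau>: "bij_betw \<tau> {..<N} {..<N}"
begin

lemma \<tau>_less: "w < N \<Longrightarrow> \<tau> w < N"
  using \<tau> by (auto dest: bij_betw_apply)

lemma \<tau>_inj: "\<tau> v = \<tau> w \<Longrightarrow> v < N \<Longrightarrow> w < N \<Longrightarrow> v = w"
  using \<tau> by (auto simp: bij_betw_def dest: inj_onD)

text \<open>
  If \<open>x\<close> and \<open>y\<close> are the two cells with arcs to a common cell, a permutation uses exactly one of
  these arcs.
\<close>

lemma choice_transfer:
  assumes f: "bij_betw f S S" and x: "x \<in> S" "f x = a \<longleftrightarrow> A"
    and y: "y \<in> S" "f y = a \<longleftrightarrow> \<not> B"
    and a: "a \<in> S" "\<And>z. z \<in> S \<Longrightarrow> f z = a \<Longrightarrow> z = x \<or> z = y" and "x \<noteq> y"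
  shows "A \<longleftrightarrow> B"
proof -
  from f a obtain z where "z \<in> S" "f z = a"
    by (metis bij_betw_def imageE)
  then show ?thesis
    using a(2) x y \<open>x \<noteq> y\<close> f by (metis bij_betw_def inj_onD)
qed

text \<open>The up arc from \<open>(w, c + 1)\<close> and the right arc from \<open>(w, c)\<close>
  compete for the same cell, so the choice at \<open>w\<close> is constant along the columns. The
  same argument across the seam yields compatibility; there \<open>M \<ge> 2\<close> keeps
  \<open>(w, 0)\<close> and \<open>(v, M - 1)\<close> distinct.\<close>

lemma choice_by_first_coordinate:
  assumes M: "M \<ge> 2" and f: "bij_betw f (cyl N M) (cyl N M)"
    and ch: "\<And>x. x \<in> cyl N M \<Longrightarrow> f x = cyl_up N x \<or> f x = cyl_right N \<tau> M x"
  obtains P where "seam_compatible N \<tau> P" "\<And>x. x \<in> cyl N M \<Longrightarrow> f x = cyl_step N \<tau> P M x"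
proof -
  define A where "A w c \<longleftrightarrow> f (w, c) = cyl_up N (w, c)" for w c
  have fA: "f (w, c) = (if A w c then (Suc w mod N, c)
      else if Suc c < M then (Suc w mod N, Suc c) else (\<tau> w, 0))"
    if "w < N" "c < M" for w c
    using ch[of "(w, c)"] that by (auto simp: A_def cyl_def cyl_up_def cyl_right_def)
  have step: "A w (Suc c) \<longleftrightarrow> A w c" if "w < N" "Suc c < M" for w c
    by (rule choice_transfer[OF f, of "(w, Suc c)" "(Suc w mod N, Suc c)" _ "(w, c)"])
      (use that N in \<open>auto simp: fA cyl_def dest: Suc_mod_inj split: if_splits\<close>)
  have A: "A w c \<longleftrightarrow> A w 0" if "w < N" "c < M" for w c
    using that(2) by (induct c) (use that(1) step in auto)
  define P where "P = {w. A w 0}"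
  have seam: "A w 0 \<longleftrightarrow> A v (M - 1)" if "v < N" "w < N" "\<tau> v = Suc w mod N" for v w
  proof (rule choice_transfer[OF f, of "(w, 0)" "(Suc w mod N, 0)" _ "(v, M - 1)"])
    fix z assume "z \<in> cyl N M" "f z = (Suc w mod N, 0)"
    then show "z = (w, 0) \<or> z = (v, M - 1)"
      using Suc_mod_inj[of "fst z" N w] \<tau>_inj[of "fst z" v] that
      by (cases z) (auto simp: fA cyl_def split: if_splits)
  qed (use that N M in \<open>auto simp: fA cyl_def\<close>)
  have "seam_compatible N \<tau> P"
    unfolding seam_compatible_def
  proof (intro allI impI)
    fix v w assume "v < N" "w < N" "\<tau> v = (w + 1) mod N"
    then show "v \<in> P \<longleftrightarrow> w \<in> P"
      using seam[of v w] A[of v "M - 1"] M by (simp add: P_def)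
  qed
  moreover have "f x = cyl_step N \<tau> P M x" if x: "x \<in> cyl N M" for x
  proof -
    obtain w c where "x = (w, c)" "w < N" "c < M" using x by (auto simp: cyl_def)
    then show ?thesis
      using A[of w c] by (auto simp: fA cyl_step_def P_def cyl_up_def cyl_right_def)
  qed
  ultimately show ?thesis by (rule that)
qed

end

section \<open>Paths and first returns for a fixed choice set\<close>

locale cylinder_choice = cylinder +
  fixes P :: "nat set"
  assumes compat: "seam_compatible N \<tau> P"
begin

abbreviation "step \<equiv> cyl_step N \<tau> P"

text \<open>Away from the seam the first coordinate after \<open>i\<close> steps is
  \<open>w + i\<close>, whatever the moves were, so this counts the right moves among
  \<open>k\<close> steps without reference to columns.\<close>

definition rights :: "nat \<Rightarrow> nat \<Rightarrow> nat" where
  "rights w k = card {i. i < k \<and> (w + i) mod N \<notin> P}"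

lemma step_eq: "step M (w, c) = (if w \<in> P then (Suc w mod N, c)
    else if Suc c < M then (Suc w mod N, Suc c) else (\<tau> w, 0))"
  by (simp add: cyl_step_def cyl_up_def cyl_right_def)

lemma finite_cyl: "finite (cyl N M)"
  by (simp add: cyl_def)

lemma step_in: "M > 0 \<Longrightarrow> x \<in> cyl N M \<Longrightarrow> step M x \<in> cyl N M"
  using N by (cases x) (simp add: step_eq cyl_def \<tau>_less)

text \<open>A collision can only be between an up move and a right move. Inside the cylinder both
  cells would have the same first coordinate, hence the same move; across the seam
  \<open>compat\<close> forbids it.\<close>

lemma inj_step: "inj_on (step M) (cyl N M)"
proof (rule inj_onI)
  fix x y assume *: "x \<in> cyl N M" "y \<in> cyl N M" "step M x = step M y"
  obtain v c w d where xy: "x = (v, c)" "y = (w, d)" "v < N" "w < N" "c < M" "d < M"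
    using * by (auto simp: cyl_def)
  have "\<tau> v = Suc w mod N \<Longrightarrow> v \<in> P \<longleftrightarrow> w \<in> P" "\<tau> w = Suc v mod N \<Longrightarrow> w \<in> P \<longleftrightarrow> v \<in> P"
    using compat xy(3,4) by (simp_all add: seam_compatible_def)
  then show "x = y"
    using *(3) xy(5,6) Suc_mod_inj[OF _ xy(3,4)] \<tau>_inj[OF _ xy(3,4)] unfolding xy(1,2) step_eq
    by (cases "v \<in> P"; cases "w \<in> P"; cases "Suc c < M"; cases "Suc d < M") (simp; fail)+
qed

lemma rights_0 [simp]: "rights w 0 = 0"
  by (simp add: rights_def)

lemma rights_Suc: "rights w (Suc k) = rights w k + (if (w + k) mod N \<in> P then 0 else 1)"
proof -
  have "{i. i < Suc k \<and> (w + i) mod N \<notin> P} =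
      {i. i < k \<and> (w + i) mod N \<notin> P} \<union> (if (w + k) mod N \<in> P then {} else {k})"
    by (auto simp: less_Suc_eq)
  then show ?thesis
    by (simp add: rights_def)
qed

lemma rights_mono: "j \<le> k \<Longrightarrow> rights w j \<le> rights w k"
  unfolding rights_def by (rule card_mono) auto

text \<open>In \<open>N\<close> steps the first coordinate meets each residue once, so the count is
  independent of the start.\<close>

lemma rights_N: "rights w N = card ({..<N} - P)"
proof -
  define r where "r i = (w + i) mod N" for i
  have inj: "inj_on r {..<N}"
    by (auto simp: inj_on_def r_def cong_add_lcancel_nat[unfolded cong_def])
  moreover have "r ` {..<N} \<subseteq> {..<N}"
    using N by (auto simp: r_def)
  ultimately have "r ` {..<N} = {..<N}"
    by (simp add: endo_inj_surj)
  then have "{..<N} - P = r ` {..<N} - P"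
    by simp
  also have "\<dots> = r ` {i. i < N \<and> r i \<notin> P}"
    by auto
  finally show ?thesis
    using inj by (simp add: rights_def r_def[symmetric] card_image inj_on_def)
qed

lemma funpow_step:
  assumes "w < N" "c + rights w k < M"
  shows "(step M ^^ k) (w, c) = ((w + k) mod N, c + rights w k)"
  using assms
proof (induct k)
  case (Suc k)
  then have "c + rights w k < M"
    by (simp add: rights_Suc split: if_splits)
  with Suc have "(step M ^^ Suc k) (w, c) = step M ((w + k) mod N, c + rights w k)"
    by simp
  also have "\<dots> = ((w + Suc k) mod N, c + rights w (Suc k))"
    using Suc.prems by (simp add: rights_Suc step_eq mod_Suc_eq split: if_splits)
  finally show ?case .
qed simp

definition pitch :: nat where "pitch = card ({..<N} - P)"

text \<open>The residue is \<open>\<tau> w - 1\<close>. Its cell in column \<open>0\<close> has its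
  up arc into the very cell where a right move from \<open>w\<close> re-enters, so it must move
  right.\<close>

lemma pred_seam:
  assumes "w < N" "w \<notin> P"
  shows "(\<tau> w + (N - 1)) mod N \<notin> P"
proof -
  have "Suc ((\<tau> w + (N - 1)) mod N) mod N = \<tau> w"
    using N \<tau>_less[OF assms(1)] by (simp add: mod_Suc_eq)
  then show ?thesis
    using compat assms N by (auto simp: seam_compatible_def)
qed

text \<open>After a re-entry, the last of \<open>N\<close> steps is a right move by
  \<open>pred_seam\<close>. Column \<open>pitch\<close> is therefore reached at step
  \<open>N\<close> and not before.\<close>

lemma rights_seam_less:
  assumes "w < N" "w \<notin> P" "k < N"
  shows "rights (\<tau> w) k < pitch"
proof -
  have "pitch = rights (\<tau> w) (Suc (N - 1))"
    using N by (simp add: pitch_def rights_N)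
  also have "\<dots> = Suc (rights (\<tau> w) (N - 1))"
    using pred_seam[OF assms(1,2)] by (simp add: rights_Suc)
  finally have "pitch = Suc (rights (\<tau> w) (N - 1))" .
  moreover have "rights (\<tau> w) k \<le> rights (\<tau> w) (N - 1)"
    using \<open>k < N\<close> by (intro rights_mono) linarith
  ultimately show ?thesis by linarith
qed

definition shift :: "nat \<times> nat \<Rightarrow> nat \<times> nat" where "shift = (\<lambda>(w, c). (w, c + pitch))"

lemma shift_in: "x \<in> cyl N M \<Longrightarrow> shift x \<in> cyl N (M + pitch)"
  by (auto simp: shift_def cyl_def)

lemma shift_eq_iff: "shift x = shift y \<longleftrightarrow> x = y"
  by (auto simp: shift_def split: prod.splits)

text \<open>
  The step on \<open>M\<close> columns is the first-return map to the last \<open>M\<close> of \<open>M + pitch\<close> columns: a path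
  entering column \<open>0\<close> needs exactly \<open>N\<close> steps to cross the first \<open>pitch\<close> columns, and these restore
  its first coordinate.
\<close>

lemma first_return:
  assumes "x \<in> cyl N M"
  obtains e where "e > 0" "(step (M + pitch) ^^ e) (shift x) = shift (step M x)"
    "\<And>k. 0 < k \<Longrightarrow> k < e \<Longrightarrow> snd ((step (M + pitch) ^^ k) (shift x)) < pitch"
proof -
  obtain w c where x: "x = (w, c)" "w < N" "c < M"
    using assms by (auto simp: cyl_def)
  show ?thesis
  proof (cases "w \<in> P \<or> Suc c < M")
    case True
    then show ?thesis
      by (intro that[of 1]) (auto simp: x cyl_step_def cyl_up_def cyl_right_def shift_def)
  next
    case False
    then have first: "step (M + pitch) (shift x) = (\<tau> w, 0)" "step M x = (\<tau> w, 0)"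
      by (auto simp: x cyl_step_def cyl_right_def shift_def)
    have pow: "(step (M + pitch) ^^ Suc k) (shift x) = ((\<tau> w + k) mod N, rights (\<tau> w) k)"
      if "k \<le> N" for k
    proof -
      have "rights (\<tau> w) k \<le> pitch"
        using rights_mono[OF that] by (simp add: pitch_def rights_N)
      then show ?thesis
        using funpow_step[of "\<tau> w" 0 k "M + pitch"] x \<tau>_less first by (simp add: funpow_swap1)
    qed
    show ?thesis
    \<comment> \<open>One step through the seam, then \<open>N\<close> steps across the inserted
      columns.\<close>
    proof (rule that[of "Suc N"])
      show "(step (M + pitch) ^^ Suc N) (shift x) = shift (step M x)"
        using pow[of N] \<tau>_less x first by (simp add: rights_N pitch_def shift_def del: funpow.simps)
      fix k assume "0 < k" "k < Suc N"
      then show "snd ((step (M + pitch) ^^ k) (shift x)) < pitch"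
        using pow[of "k - 1"] rights_seam_less[of w "k - 1"] x False
        by (cases k) (auto simp del: funpow.simps)
    qed simp
  qed
qed

text \<open>In \<open>N\<close> steps the column would grow by \<open>pitch\<close>, enough to leave
  the inserted columns. At the least such time the path has not run past the last column, since a
  step adds at most one.\<close>

lemma reaches_shift:
  assumes "M > 0" "z \<in> cyl N (M + pitch)"
  obtains k x where "x \<in> cyl N M" "(step (M + pitch) ^^ k) z = shift x"
proof -
  obtain w c where z: "z = (w, c)" "w < N" "c < M + pitch"
    using assms by (auto simp: cyl_def)
  define k where "k = (LEAST k. c + rights w k \<ge> pitch)"
  have k: "c + rights w k \<ge> pitch"
    unfolding k_def by (rule LeastI[of _ N]) (simp add: rights_N pitch_def)
  have "c + rights w k < M + pitch"
  proof (cases k)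
    case (Suc j)
    then have "c + rights w j < pitch"
      using not_less_Least[of j "\<lambda>k. c + rights w k \<ge> pitch"] by (simp add: k_def)
    with Suc \<open>M > 0\<close> show ?thesis
      by (simp add: rights_Suc)
  qed (use z in simp)
  then show ?thesis
    using k z N funpow_step[of w c k "M + pitch"]
    by (intro that[of "((w + k) mod N, c + rights w k - pitch)" k]) (auto simp: cyl_def shift_def)
qed

text \<open>Forwards, a path between shifted cells is cut at its visits to shifted cells, each piece
  being one step on \<open>M\<close> columns. Backwards, the shifted cells lie in one orbit and
  every cell runs into one of them.\<close>

lemma cyclic_on_add_pitch:
  assumes M: "M > 0"
  shows "cyclic_on (step (M + pitch)) (cyl N (M + pitch)) \<longleftrightarrow> cyclic_on (step M) (cyl N M)"
proof
  let ?F = "step (M + pitch)" and ?S = "cyl N (M + pitch)"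
  assume F: "cyclic_on ?F ?S"
  have reach: "y \<in> orbit (step M) x"
    if "k > 0" "(?F ^^ k) (shift x) = shift y" "x \<in> cyl N M" for k x y
    using that
  proof (induct k arbitrary: x rule: less_induct)
    case (less k)
    obtain e where e: "e > 0" "(?F ^^ e) (shift x) = shift (step M x)"
      and small: "\<And>k. 0 < k \<Longrightarrow> k < e \<Longrightarrow> snd ((?F ^^ k) (shift x)) < pitch"
      by (rule first_return[OF less.prems(3)]) blast
    \<comment> \<open>At time \<open>k\<close> the path is at a shifted cell, whose column is at
      least \<open>pitch\<close>, so \<open>k\<close> cannot precede the return time
      \<open>e\<close>.\<close>
    have "e \<le> k"
      using small[of k] less.prems by (force simp: shift_def split: prod.splits)
    show ?case
    proof (cases "e = k")
      case True
      then show ?thesis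
        using e less.prems by (simp add: shift_eq_iff orbit.base)
    next
      case False
      have "(?F ^^ (k - e)) (shift (step M x)) = (?F ^^ (k - e + e)) (shift x)"
        by (simp only: funpow_add o_apply e)
      then have "(?F ^^ (k - e)) (shift (step M x)) = shift y"
        using \<open>e \<le> k\<close> less.prems by simp
      then have "y \<in> orbit (step M) (step M x)"
        using less.hyps[of "k - e"] e \<open>e \<le> k\<close> False step_in[OF M] less.prems by simp
      then show ?thesis
        by (rule orbit_subset)
    qed
  qed
  have "orbit (step M) (0, 0) = cyl N M"
  proof
    show "orbit (step M) (0, 0) \<subseteq> cyl N M"
    proof
      fix y assume "y \<in> orbit (step M) (0, 0)"
      then show "y \<in> cyl N M"
        by induct (use step_in[OF M] M N in \<open>auto simp: cyl_def\<close>)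
    qed
    have 0: "(0, 0) \<in> cyl N M"
      using M N by (simp add: cyl_def)
    show "cyl N M \<subseteq> orbit (step M) (0, 0)"
    proof
      fix y assume "y \<in> cyl N M"
      then have "shift y \<in> orbit ?F (shift (0, 0))"
        using orbit_cyclic_eq3[OF F shift_in[OF 0]] shift_in by simp
      then obtain k where "k > 0" "(?F ^^ k) (shift (0, 0)) = shift y"
        by (auto simp: orbit_altdef)
      then show "y \<in> orbit (step M) (0, 0)"
        using 0 by (rule reach)
    qed
  qed
  then show "cyclic_on (step M) (cyl N M)"
    using M N by (auto simp: cyclic_on_def cyl_def)
next
  let ?F = "step (M + pitch)" and ?S = "cyl N (M + pitch)"
  assume f: "cyclic_on (step M) (cyl N M)"
  have 0: "(0, 0) \<in> cyl N M"
    using M N by (simp add: cyl_def)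
  have F_in: "?F x \<in> ?S" if "x \<in> ?S" for x
    using step_in[OF _ that] M by simp
  \<comment> \<open>\<open>?F\<close> is bijective only on \<open>?S\<close>; restricting it gives a
    permutation of the whole type with the same orbits inside \<open>?S\<close>, to which the facts
    on finite permutations apply.\<close>
  have self: "z \<in> orbit ?F z" if "z \<in> ?S" for z
  proof -
    let ?g = "perm_restrict ?F ?S"
    have "bij_betw ?F ?S ?S"
      using inj_step F_in by (simp add: bij_betw_def endo_inj_surj image_subset_iff finite_cyl)
    then have "?g permutes ?S"
      using bij_betw_cong[of ?S ?F ?g ?S]
      by (intro bij_imp_permutes) (simp_all add: perm_restrict_simps)
    then have "permutation ?g"
      unfolding permutation_permutes using finite_cyl by (intro exI[of _ ?S] conjI)
    then have "z \<in> orbit ?g z"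
      by (rule permutation_self_in_orbit)
    also have "orbit ?g z = orbit ?F z"
      using that F_in by (intro orbit_cong0[of _ ?S]) (simp_all add: perm_restrict_simps)
    finally show ?thesis .
  qed
  have shift_step: "shift (step M x) \<in> orbit ?F (shift x)" if "x \<in> cyl N M" for x
    using first_return[OF that] by (metis (mono_tags, lifting) orbit_altdef mem_Collect_eq)
  have shifts: "shift x \<in> orbit ?F (shift (0, 0))" if "x \<in> cyl N M" for x
  proof -
    from that have "x \<in> orbit (step M) (0, 0)"
      using f 0 by (simp add: orbit_cyclic_eq3)
    then show ?thesis
    proof induct
      case base
      then show ?case using shift_step 0 by simp
    next
      case (step y)
      then have "y \<in> cyl N M"
        using orbit_cyclic_eq3[OF f 0] by simp
      then show ?case
        using step shift_step orbit_trans by metis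
    qed
  qed
  have "orbit ?F (shift (0, 0)) = ?S"
  proof
    show "orbit ?F (shift (0, 0)) \<subseteq> ?S"
    proof
      fix y assume "y \<in> orbit ?F (shift (0, 0))"
      then show "y \<in> ?S"
        by induct (use F_in shift_in[OF 0] in auto)
    qed
    show "?S \<subseteq> orbit ?F (shift (0, 0))"
    proof
      fix z assume z: "z \<in> ?S"
      obtain k x where x: "x \<in> cyl N M" "(?F ^^ k) z = shift x"
        using reaches_shift[OF M z] .
      have "shift x \<in> orbit ?F z"
        using funpow_in_orbit[OF self[OF z], of k] x by simp
      then have "z \<in> orbit ?F (shift x)"
        using self[OF z] by (rule orbit_swap[rotated])
      then show "z \<in> orbit ?F (shift (0, 0))"
        using shifts[OF x(1)] by (rule orbit_trans)
    qed
  qed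
  then show "cyclic_on ?F ?S"
    using shift_in[OF 0] by (auto simp: cyclic_on_def)
qed

lemma cyclic_on_add_dvd:
  assumes "M > 0" "pitch dvd d"
  shows "cyclic_on (step (M + d)) (cyl N (M + d)) \<longleftrightarrow> cyclic_on (step M) (cyl N M)"
proof -
  have "cyclic_on (step (M + pitch * t)) (cyl N (M + pitch * t)) \<longleftrightarrow> cyclic_on (step M) (cyl N M)" for t
  proof (induct t)
    case (Suc t)
    have "M + pitch * Suc t = M + pitch * t + pitch" "M + pitch * t > 0"
      using \<open>M > 0\<close> by simp_all
    then show ?case
      using Suc cyclic_on_add_pitch[of "M + pitch * t"] by metis
  qed simp
  then show ?thesis
    using \<open>pitch dvd d\<close> by (auto elim: dvdE)
qed

text \<open>Without right moves no path leaves its column, while there are at least two columns.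
  Positivity is needed for \<open>pitch\<close> to divide the number of added columns.\<close>

lemma cyclic_on_imp_pitch_pos:
  assumes "M \<ge> 2" "cyclic_on (step M) (cyl N M)"
  shows "pitch > 0"
proof (rule ccontr)
  assume "\<not> pitch > 0"
  then have P: "w \<in> P" if "w < N" for w
    using that by (auto simp: pitch_def)
  have "(0, 0) \<in> cyl N M" "(0, 1) \<in> cyl N M"
    using assms(1) N by (auto simp: cyl_def)
  then have "(0, 1) \<in> orbit (step M) (0, 0)"
    using orbit_cyclic_eq3[OF assms(2)] by simp
  moreover have "fst y < N \<and> snd y = 0" if "y \<in> orbit (step M) (0, 0)" for y
    using that by induct (use N in \<open>auto simp: cyl_step_def cyl_up_def P split: prod.splits\<close>)
  ultimately show False
    by fastforce
qed

end

section \<open>Divisibility of the number of right-moving residues\<close>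

lemma card_translation_invariant:
  fixes n m :: nat
  assumes n: "n > 0" and Q: "finite Q" and \<rho>: "bij_betw \<rho> Q Q"
    and cong: "\<And>w. w \<in> Q \<Longrightarrow> [\<rho> w + m = w] (mod n)"
  shows "n div gcd n m dvd card Q"
proof -
  \<comment> \<open>The number of elements of \<open>Q\<close> in the class of \<open>j\<close>. As
    \<open>\<rho>\<close> carries the class of \<open>j + m\<close> onto that of \<open>j\<close>,
    \<open>q\<close> has period \<open>m\<close> besides the evident period
    \<open>n\<close>.\<close>
  define q where "q j = card {w \<in> Q. [w = j] (mod n)}" for j
  have add_m: "q (j + m) = q j" for j
  proof -
    have *: "[w = j + m] (mod n) \<longleftrightarrow> [\<rho> w = j] (mod n)" if "w \<in> Q" for w
      using cong[OF that] cong_add_rcancel_nat by (metis cong_sym cong_trans)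
    have "bij_betw \<rho> {w \<in> Q. [w = j + m] (mod n)} {w \<in> Q. [w = j] (mod n)}"
      unfolding bij_betw_def
    proof
      show "inj_on \<rho> {w \<in> Q. [w = j + m] (mod n)}"
        using \<rho> by (auto simp: bij_betw_def inj_on_def)
      have Q_image: "Q = \<rho> ` Q"
        using \<rho> by (simp add: bij_betw_def)
      have "{w \<in> Q. [w = j] (mod n)} = \<rho> ` {w \<in> Q. [\<rho> w = j] (mod n)}"
        by (subst Q_image) auto
      also have "{w \<in> Q. [\<rho> w = j] (mod n)} = {w \<in> Q. [w = j + m] (mod n)}"
        using * by auto
      finally show "\<rho> ` {w \<in> Q. [w = j + m] (mod n)} = {w \<in> Q. [w = j] (mod n)}" ..
    qed
    then show ?thesis
      by (simp add: q_def bij_betw_same_card)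
  qed
  have add_mult_m: "q (j + m * y) = q j" for j y
  proof (induct y)
    case (Suc y)
    have "q (j + m * Suc y) = q (j + m * y + m)"
      by (simp add: algebra_simps)
    then show ?case
      using Suc add_m by simp
  qed simp
  have add_mult_n: "q (j + n * x) = q j" for j x
    by (simp add: q_def cong_def)
  define g where "g = gcd n m"
  \<comment> \<open>Two periods give their gcd as a period; this form of Bezout avoids negative
    coefficients.\<close>
  obtain x y where "n * x = m * y + g"
    using bezout_nat[of n m] n by (auto simp: g_def)
  then have "j + n * x = j + g + m * y" for j
    by simp
  then have add_g: "q (j + g) = q j" for j
    using add_mult_m add_mult_n by metis
  have add_mult_g: "q (j + t * g) = q j" for j t
  proof (induct t)
    case (Suc t)
    then show ?case
      using add_g[of "j + t * g"] by (simp add: algebra_simps)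
  qed simp
  have "card Q = sum (\<lambda>_. 1) Q"
    by simp
  also have "\<dots> = (\<Sum>j<n. sum (\<lambda>_. 1) {w \<in> Q. w mod n = j})"
    using n Q by (intro sum.group[symmetric]) auto
  also have "\<dots> = (\<Sum>j<n. q j)"
    by (intro sum.cong) (simp_all add: q_def cong_def)
  also have "\<dots> = (\<Sum>j<n div g * g. q j)"
    by (simp add: g_def)
  \<comment> \<open>Cut one period of length \<open>n\<close> into \<open>n div g\<close> blocks of
    length \<open>g\<close>; by \<open>add_mult_g\<close> all blocks have the same sum.\<close>
  also have "\<dots> = (\<Sum>t<n div g. \<Sum>j=t * g..<t * g + g. q j)"
    by (rule sum.nat_group[symmetric])
  also have "\<dots> = (\<Sum>t<n div g. \<Sum>j<g. q j)"
  proof (rule sum.cong)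
    fix t
    have "(\<Sum>j=t * g..<t * g + g. q j) = (\<Sum>j=0..<g. q (j + t * g))"
      using sum.shift_bounds_nat_ivl[of q 0 "t * g" g] by (simp add: add.commute)
    then show "(\<Sum>j=t * g..<t * g + g. q j) = (\<Sum>j<g. q j)"
      by (simp add: add_mult_g lessThan_atLeast0)
  qed simp
  finally show ?thesis
    by (simp add: g_def)
qed

lemma (in cylinder_choice) dvd_pitch:
  assumes "n > 0" "n dvd N" and \<tau>: "\<And>w. w < N \<Longrightarrow> [\<tau> w + m = w + 1] (mod n)"
  shows "n div gcd n m dvd pitch"
  unfolding pitch_def
proof (rule card_translation_invariant)
  \<comment> \<open>Adding \<open>N - 1\<close> subtracts \<open>1\<close> modulo \<open>N\<close>.
    By \<open>pred_seam\<close> this injective map preserves the finite complement of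
    \<open>P\<close>, hence permutes it.\<close>
  define \<rho> where "\<rho> w = (\<tau> w + (N - 1)) mod N" for w
  have "inj_on \<rho> {..<N}"
  proof (rule inj_onI)
    fix v w assume "v \<in> {..<N}" "w \<in> {..<N}" "\<rho> v = \<rho> w"
    then have "[\<tau> v + (N - 1) = \<tau> w + (N - 1)] (mod N)"
      by (simp add: \<rho>_def cong_def)
    then have "[\<tau> v = \<tau> w] (mod N)"
      by (simp add: cong_add_rcancel_nat)
    then show "v = w"
      using \<open>v \<in> _\<close> \<open>w \<in> _\<close> \<tau>_less \<tau>_inj by (simp add: cong_def)
  qed
  then have "inj_on \<rho> ({..<N} - P)"
    by (auto simp: inj_on_def)
  moreover have "\<rho> ` ({..<N} - P) \<subseteq> {..<N} - P"
    using pred_seam N by (auto simp: \<rho>_def)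
  ultimately show "bij_betw \<rho> ({..<N} - P) ({..<N} - P)"
    by (simp add: bij_betw_def endo_inj_surj)
  fix w assume "w \<in> {..<N} - P"
  then have "[\<tau> w + m = w + 1] (mod n)"
    using \<tau> by simp
  moreover have "[\<rho> w + 1 = \<tau> w] (mod n)"
  proof -
    have "[\<rho> w + 1 = \<tau> w + N] (mod N)"
      using N by (simp add: \<rho>_def cong_def mod_Suc_eq)
    then show ?thesis
      using \<open>n dvd N\<close> by (metis cong_add_lcancel_0_nat cong_0_iff cong_dvd_modulus_nat cong_trans)
  qed
  ultimately have "[\<rho> w + m + 1 = w + 1] (mod n)"
    by (smt (verit) add.commute add.left_commute cong_add_rcancel_nat cong_trans)
  then show "[\<rho> w + m = w] (mod n)"
    by (simp only: cong_add_rcancel_nat)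
qed (use assms in auto)


section \<open>The grid as a cylinder\<close>

lemma choice_cycle_conj:
  assumes \<phi>: "bij_betw \<phi> S T"
    and u: "\<And>x. x \<in> S \<Longrightarrow> \<phi> (u x) = u' (\<phi> x)" and r: "\<And>x. x \<in> S \<Longrightarrow> \<phi> (r x) = r' (\<phi> x)"
    and f: "cyclic_on f S" "\<And>x. x \<in> S \<Longrightarrow> f x = u x \<or> f x = r x"
  obtains f' where "cyclic_on f' T" "\<And>y. y \<in> T \<Longrightarrow> f' y = u' y \<or> f' y = r' y"
proof -
  define f' where "f' = \<phi> \<circ> f \<circ> the_inv_into S \<phi>"
  have inj: "inj_on \<phi> S" and T: "T = \<phi> ` S"
    using \<phi> by (auto simp: bij_betw_def)
  have f': "f' (\<phi> x) = \<phi> (f x)" if "x \<in> S" for x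
    using that by (simp add: f'_def the_inv_into_f_f[OF inj])
  show ?thesis
  proof
    show "cyclic_on f' T"
      unfolding T using f(1) f' by (rule cyclic_on_image)
    fix y assume "y \<in> T"
    then obtain x where x: "x \<in> S" "y = \<phi> x"
      unfolding T by blast
    show "f' y = u' y \<or> f' y = r' y"
      using f(2)[OF x(1)] unfolding x(2) f'[OF x(1)] u[OF x(1), symmetric] r[OF x(1), symmetric]
      by metis
  qed
qed

lemma ex_choice_cycle_conj_iff:
  assumes \<phi>: "bij_betw \<phi> S T"
    and u: "\<And>x. x \<in> S \<Longrightarrow> \<phi> (u x) = u' (\<phi> x)" and r: "\<And>x. x \<in> S \<Longrightarrow> \<phi> (r x) = r' (\<phi> x)"
    and closed: "\<And>x. x \<in> S \<Longrightarrow> u x \<in> S" "\<And>x. x \<in> S \<Longrightarrow> r x \<in> S"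
  shows "(\<exists>f. cyclic_on f S \<and> (\<forall>x\<in>S. f x = u x \<or> f x = r x)) \<longleftrightarrow>
    (\<exists>f. cyclic_on f T \<and> (\<forall>y\<in>T. f y = u' y \<or> f y = r' y))" (is "?L \<longleftrightarrow> ?R")
proof
  assume ?L
  then obtain f where f: "cyclic_on f S" "\<And>x. x \<in> S \<Longrightarrow> f x = u x \<or> f x = r x"
    by blast
  show ?R
    by (rule choice_cycle_conj[OF \<phi> u r f]) auto
next
  assume ?R
  then obtain f where f: "cyclic_on f T" "\<And>y. y \<in> T \<Longrightarrow> f y = u' y \<or> f y = r' y"
    by blast
  let ?\<psi> = "the_inv_into S \<phi>"
  have inj: "inj_on \<phi> S"
    using \<phi> by (simp add: bij_betw_def)
  have inv: "?\<psi> y \<in> S" "\<phi> (?\<psi> y) = y" if "y \<in> T" for y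
    using that \<phi> bij_betw_the_inv_into[OF \<phi>]
    by (auto dest: bij_betw_apply simp: f_the_inv_into_f_bij_betw)
  have "?\<psi> (u' y) = u (?\<psi> y)" if "y \<in> T" for y
    using inv[OF that] u closed the_inv_into_f_f[OF inj] by metis
  moreover have "?\<psi> (r' y) = r (?\<psi> y)" if "y \<in> T" for y
    using inv[OF that] r closed the_inv_into_f_f[OF inj] by metis
  ultimately show ?L
    by (rule choice_cycle_conj[OF bij_betw_the_inv_into[OF \<phi>] _ _ f]) auto
qed

text \<open>The height after a right move out of the last column of a half. The left half,
  \<open>h < 2 * n\<close>, passes to the same row of the right half. The right half wraps to the
  left one with a turn by \<open>n\<close> rows: rows at least \<open>n\<close> have
  \<open>h < 3 * n\<close>, the others \<open>h \<ge> 3 * n\<close>.\<close>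

definition seam :: "nat \<Rightarrow> nat \<Rightarrow> nat" where
  "seam n h = (if h < 2 * n then h + 2 * n else if h < 3 * n then h - n else h - 3 * n)"

text \<open>
  Modulo \<open>4 * n\<close>, the summand \<open>(4 * n - 1) * (m - 1)\<close> is \<open>1 - m\<close>: it turns the first
  coordinate of a cell of column \<open>m - 1\<close> back into its height.
\<close>

definition seam_shift :: "nat \<Rightarrow> nat \<Rightarrow> nat \<Rightarrow> nat" where
  "seam_shift n m w = seam n ((w + (4 * n - 1) * (m - 1)) mod (4 * n))"

text \<open>
  Stacking the right half of the grid on top of the left half gives a cylinder of circumference
  \<open>4 * n\<close> and length \<open>m\<close>; \<open>height\<close> is the position on its circumference, counted upwards.
\<close>

definition height :: "nat \<Rightarrow> nat \<Rightarrow> nat \<times> nat \<Rightarrow> nat" where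
  "height n m = (\<lambda>(i, c). if c < m then 2 * n - 1 - i else 4 * n - 1 - i)"

definition column :: "nat \<Rightarrow> nat \<times> nat \<Rightarrow> nat" where
  "column m = (\<lambda>(i, c). if c < m then c else c - m)"

definition coords :: "nat \<Rightarrow> nat \<Rightarrow> nat \<times> nat \<Rightarrow> nat \<times> nat" where
  "coords n m \<alpha> = ((height n m \<alpha> + column m \<alpha>) mod (4 * n), column m \<alpha>)"

lemma bij_seam_shift:
  assumes "n > 0"
  shows "bij_betw (seam_shift n m) {..<4 * n} {..<4 * n}"
proof -
  have "inj_on (seam_shift n m) {..<4 * n}"
  proof (rule inj_onI)
    fix v w assume *: "v \<in> {..<4 * n}" "w \<in> {..<4 * n}" "seam_shift n m v = seam_shift n m w"
    have "h = k" if "seam n h = seam n k" "h < 4 * n" "k < 4 * n" for h k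
      using that by (simp add: seam_def split: if_splits)
    then have "[v + (4 * n - 1) * (m - 1) = w + (4 * n - 1) * (m - 1)] (mod 4 * n)"
      using *(3) assms by (simp add: seam_shift_def cong_def)
    then have "[v = w] (mod 4 * n)"
      by (simp only: cong_add_rcancel_nat)
    then show "v = w"
      using *(1,2) by (simp add: cong_def)
  qed
  moreover have "seam n h < 4 * n" if "h < 4 * n" for h
    using that by (auto simp: seam_def)
  then have "seam_shift n m ` {..<4 * n} \<subseteq> {..<4 * n}"
    using assms by (auto simp: seam_shift_def)
  ultimately show ?thesis
    by (simp add: bij_betw_def endo_inj_surj)
qed

text \<open>Every branch of \<open>seam\<close> translates by a multiple of \<open>n\<close>, so
  modulo \<open>n\<close> only the translation by \<open>1 - m\<close> remains.\<close>

lemma seam_shift_cong: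
  assumes "n > 0" "m > 0"
  shows "[seam_shift n m w + m = w + 1] (mod n)"
proof -
  define h where "h = (w + (4 * n - 1) * (m - 1)) mod (4 * n)"
  have "[seam n h = h] (mod n)"
  proof -
    consider "h < 2 * n" | "\<not> h < 2 * n" "h < 3 * n" | "\<not> h < 3 * n"
      by blast
    then show ?thesis
    proof cases
      case 2
      then obtain k where "h = k + n"
        by (intro that[of "h - n"]) simp
      with 2 show ?thesis by (simp add: seam_def cong_def)
    next
      case 3
      then obtain k where "h = k + n * 3"
        by (intro that[of "h - n * 3"]) simp
      with 3 show ?thesis by (simp add: seam_def cong_def mult.commute)
    qed (simp add: seam_def cong_def)
  qed
  then have "[seam n h + m = h + m] (mod n)"
    by (simp only: cong_add_rcancel_nat)
  also have "[h + m = w + (4 * n - 1) * (m - 1) + m] (mod n)"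
  proof -
    have "[h = w + (4 * n - 1) * (m - 1)] (mod 4 * n)"
      by (simp add: h_def)
    then have "[h = w + (4 * n - 1) * (m - 1)] (mod n)"
      by (rule cong_dvd_modulus_nat) simp
    then show ?thesis
      by (simp only: cong_add_rcancel_nat)
  qed
  also have "w + (4 * n - 1) * (m - 1) + m = w + 1 + n * (4 * (m - 1))"
  proof -
    obtain m' n' where "m = Suc m'" "4 * n = Suc n'"
      using assms by (metis gr0_conv_Suc nat_0_less_mult_iff zero_less_numeral)
    then have "n * (4 * (m - 1)) = Suc n' * m'"
      by (metis diff_Suc_1 mult.assoc mult.commute)
    then show ?thesis
      using \<open>m = _\<close> \<open>4 * n = _\<close> by simp
  qed
  also have "[\<dots> = w + 1] (mod n)"
    by (simp add: cong_def)
  finally show ?thesis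
    by (simp add: seam_shift_def h_def)
qed

text \<open>Only \<open>m\<close> modulo \<open>4 * n\<close> matters, so both grids of the theorem
  share one re-entry map.\<close>

lemma seam_shift_add: "m > 0 \<Longrightarrow> seam_shift n (m + 4 * n * t) = seam_shift n m"
proof
  fix w assume "m > 0"
  then have "(4 * n - 1) * (m + 4 * n * t - 1) = (4 * n - 1) * (m - 1) + 4 * n * ((4 * n - 1) * t)"
    by (cases m) (simp_all add: algebra_simps)
  then have "w + (4 * n - 1) * (m + 4 * n * t - 1) =
      w + (4 * n - 1) * (m - 1) + 4 * n * ((4 * n - 1) * t)"
    by simp
  then show "seam_shift n (m + 4 * n * t) w = seam_shift n m w"
    unfolding seam_shift_def by (simp only: mod_mult_self2)
qed

lemma bij_coords:
  assumes "n > 0" "m > 0"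
  shows "bij_betw (coords n m) (cells n m) (cyl (4 * n) m)"
proof -
  have h: "height n m \<alpha> < 4 * n" "column m \<alpha> < m" if "\<alpha> \<in> cells n m" for \<alpha>
    using that assms by (auto simp: cells_def height_def column_def)
  have "inj_on (coords n m) (cells n m)"
  proof (rule inj_onI)
    fix \<alpha> \<beta> assume *: "\<alpha> \<in> cells n m" "\<beta> \<in> cells n m" "coords n m \<alpha> = coords n m \<beta>"
    then have col: "column m \<alpha> = column m \<beta>"
      by (simp add: coords_def)
    with *(3) have "[height n m \<alpha> + column m \<alpha> = height n m \<beta> + column m \<alpha>] (mod 4 * n)"
      by (simp add: coords_def cong_def)
    then have "[height n m \<alpha> = height n m \<beta>] (mod 4 * n)"
      by (simp only: cong_add_rcancel_nat)
    then have "height n m \<alpha> = height n m \<beta>"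
      using h *(1,2) by (simp add: cong_def)
    then show "\<alpha> = \<beta>"
      using col *(1,2)
      by (cases \<alpha>; cases \<beta>) (auto simp: cells_def height_def column_def split: if_splits)
  qed
  moreover have "coords n m ` cells n m \<subseteq> cyl (4 * n) m"
    using assms h by (auto simp: coords_def cyl_def)
  moreover have "card (cells n m) = card (cyl (4 * n) m)"
    by (simp add: card_cells cyl_def)
  moreover have "finite (cyl (4 * n) m)"
    by (simp add: cyl_def)
  ultimately show ?thesis
    by (metis bij_betw_def card_image card_subset_eq)
qed

text \<open>The shift by \<open>m\<close> columns above row \<open>0\<close> leads from the top of
  either half to the bottom of the other; this closes the stacked halves into a circle.\<close>

lemma coords_up:
  assumes "n > 0" "m > 0" "\<alpha> \<in> cells n m"
  shows "coords n m (up n m \<alpha>) = cyl_up (4 * n) (coords n m \<alpha>)"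
proof -
  obtain i c where \<alpha>: "\<alpha> = (i, c)" "i < 2 * n" "c < 2 * m"
    using assms(3) by (auto simp: cells_def)
  have "column m (up n m \<alpha>) = column m \<alpha>"
    using \<alpha> by (auto simp: up_def column_def half_turn)
  moreover have "height n m (up n m \<alpha>) = Suc (height n m \<alpha>) mod (4 * n)"
    using \<alpha> assms(1) by (cases "i = 0") (auto simp: up_def height_def half_turn)
  ultimately show ?thesis
    by (simp add: coords_def cyl_up_def mod_simps)
qed

lemma coords_right:
  assumes "n > 0" "m > 0" "\<alpha> \<in> cells n m"
  shows "coords n m (right n m \<alpha>) = cyl_right (4 * n) (seam_shift n m) m (coords n m \<alpha>)"
proof -
  obtain i c where \<alpha>: "\<alpha> = (i, c)" "i < 2 * n" "c < 2 * m"
    using assms(3) by (auto simp: cells_def)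
  show ?thesis
  proof (cases "Suc (column m \<alpha>) < m")
    case True
    then have "column m (right n m \<alpha>) = Suc (column m \<alpha>)"
      "height n m (right n m \<alpha>) = height n m \<alpha>"
      using \<alpha> by (auto simp: right_def column_def height_def split: if_splits)
    with True show ?thesis
      by (simp add: coords_def cyl_right_def mod_simps)
  next
    case False
    \<comment> \<open>The move from column \<open>m - 1\<close> to column \<open>m\<close> is
      interior to the grid but changes halves, so it crosses the seam as well.\<close>
    then have c: "c = m - 1 \<or> c = 2 * m - 1"
      using \<alpha> by (auto simp: column_def split: if_splits)
    have col: "column m \<alpha> = m - 1" "column m (right n m \<alpha>) = 0"
      using c \<alpha> assms by (auto simp: column_def right_def)
    have h: "height n m (right n m \<alpha>) = seam n (height n m \<alpha>)" "height n m \<alpha> < 4 * n"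
      "height n m (right n m \<alpha>) < 4 * n"
      using c \<alpha> assms by (auto simp: height_def right_def seam_def half_turn)
    obtain m' n' where mn: "m = Suc m'" "4 * n = Suc n'"
      using assms by (metis gr0_conv_Suc nat_0_less_mult_iff zero_less_numeral)
    have "((height n m \<alpha> + (m - 1)) mod (4 * n) + (4 * n - 1) * (m - 1)) mod (4 * n) =
        (height n m \<alpha> + (m - 1) + (4 * n - 1) * (m - 1)) mod (4 * n)"
      by (simp add: mod_simps)
    also have "height n m \<alpha> + (m - 1) + (4 * n - 1) * (m - 1) = height n m \<alpha> + 4 * n * (m - 1)"
      unfolding mn by simp
    also have "\<dots> mod (4 * n) = height n m \<alpha>"
      using h by simp
    finally have "seam_shift n m ((height n m \<alpha> + (m - 1)) mod (4 * n)) = seam n (height n m \<alpha>)"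
      by (simp add: seam_shift_def)
    then show ?thesis
      using h False by (simp add: coords_def cyl_right_def col)
  qed
qed

lemma hamiltonian_torus_grid_iff:
  assumes "n > 0" "m > 0"
  shows "hamiltonian (torus_grid n m) \<longleftrightarrow> (\<exists>f. cyclic_on f (cyl (4 * n) m) \<and>
    (\<forall>x\<in>cyl (4 * n) m. f x = cyl_up (4 * n) x \<or> f x = cyl_right (4 * n) (seam_shift n m) m x))"
proof -
  have arc: "(\<exists>e\<in>arcs (torus_grid n m). tail (torus_grid n m) e = \<alpha> \<and> head (torus_grid n m) e = \<beta>)
      \<longleftrightarrow> \<beta> = up n m \<alpha> \<or> \<beta> = right n m \<alpha>" if "\<alpha> \<in> cells n m" for \<alpha> \<beta>
    using that by (cases \<alpha>; cases \<beta>) (auto simp: torus_grid_def Bex_def)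
  have "verts (torus_grid n m) = cells n m"
    by (simp add: torus_grid_def)
  then have "hamiltonian (torus_grid n m) \<longleftrightarrow> (\<exists>f. cyclic_on f (cells n m) \<and>
      (\<forall>x\<in>cells n m. f x = up n m x \<or> f x = right n m x))"
    unfolding hamiltonian_iff_cyclic_on[OF wf_digraph_torus_grid[OF assms]] by (simp add: arc)
  also have "\<dots> \<longleftrightarrow> (\<exists>f. cyclic_on f (cyl (4 * n) m) \<and>
    (\<forall>x\<in>cyl (4 * n) m. f x = cyl_up (4 * n) x \<or> f x = cyl_right (4 * n) (seam_shift n m) m x))"
  proof (rule ex_choice_cycle_conj_iff[where u = "up n m" and r = "right n m"
        and u' = "cyl_up (4 * n)" and r' = "cyl_right (4 * n) (seam_shift n m) m"])
    show "bij_betw (coords n m) (cells n m) (cyl (4 * n) m)"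
      using assms by (rule bij_coords)
  qed (simp_all add: coords_up[OF assms] coords_right[OF assms]
      bij_betw_apply[OF bij_betw_up[OF assms]] bij_betw_apply[OF bij_betw_right[OF assms]])
  finally show ?thesis .
qed

text \<open>Write \<open>pitch\<close> as \<open>n div g * s\<close>. Since \<open>4 * n\<close> is
  \<open>n div g * (4 * g)\<close>, the bound \<open>pitch \<le> 4 * n\<close> becomes
  \<open>s \<le> 4 * g\<close>, so \<open>s\<close> divides the factorial while
  \<open>n div g\<close> divides \<open>n\<close>.\<close>

lemma (in cylinder_choice) pitch_dvd_added_columns:
  assumes "N = 4 * n" "n > 0" "m > 0" "\<tau> = seam_shift n m" "pitch > 0"
  shows "pitch dvd 4 * n * fact (4 * gcd n m)"
proof -
  define g where "g = gcd n m"
  have "n div g dvd pitch"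
    unfolding g_def
  proof (rule dvd_pitch)
    show "[\<tau> w + m = w + 1] (mod n)" if "w < N" for w
      unfolding assms(4) using assms(2,3) by (rule seam_shift_cong)
  qed (use assms in auto)
  then obtain s where s: "pitch = n div g * s"
    by (rule dvdE)
  have n: "n = n div g * g"
    by (simp add: g_def)
  have "pitch \<le> card {..<N}"
    unfolding pitch_def by (rule card_mono) auto
  then have "pitch \<le> 4 * n"
    by (simp add: assms(1))
  moreover have "4 * n = n div g * (4 * g)"
    using n by (metis mult.left_commute)
  ultimately have "n div g * s \<le> n div g * (4 * g)"
    using s by linarith
  moreover have "n div g > 0"
    using s \<open>pitch > 0\<close> by (cases "n div g") auto
  ultimately have "s \<le> 4 * g"
    by (rule mult_left_le_imp_le)
  moreover have "s \<ge> 1"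
    using s \<open>pitch > 0\<close> by (cases s) auto
  ultimately have "s dvd fact (4 * g)"
    by (simp add: dvd_fact)
  then have "pitch dvd n * fact (4 * g)"
    unfolding s by (intro mult_dvd_mono) (metis n dvd_triv_left, simp)
  then show ?thesis
    unfolding g_def[symmetric] by (simp add: mult.assoc)
qed

section \<open>Comparison of the two grids\<close>

theorem theorem4:
  fixes n m g :: nat
  assumes "n > 1" and "m > 1" and "g = gcd n m"
  shows "hamiltonian (torus_grid n m) \<longleftrightarrow>
         hamiltonian (torus_grid n (m + 4 * fact (4 * g) * n))"
proof -
  define \<tau> where "\<tau> = seam_shift n m"
  define d where "d = 4 * n * fact (4 * g)"
  let ?N = "4 * n"
  interpret cylinder ?N \<tau>
    using assms(1) by unfold_locales (simp_all add: \<tau>_def bij_seam_shift)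
  \<comment> \<open>The unordered pair covers both directions at once: the set \<open>P\<close> read
    off from a cycle on \<open>M\<close> columns also yields a cycle on \<open>M'\<close> columns,
    as \<open>pitch\<close> depends on \<open>P\<close> and not on the number of columns.\<close>
  have transfer: "\<exists>f. cyclic_on f (cyl ?N M') \<and>
      (\<forall>x\<in>cyl ?N M'. f x = cyl_up ?N x \<or> f x = cyl_right ?N \<tau> M' x)"
    if f: "cyclic_on f (cyl ?N M)" "\<forall>x\<in>cyl ?N M. f x = cyl_up ?N x \<or> f x = cyl_right ?N \<tau> M x"
      and M: "{M, M'} = {m, m + d}" for f M M'
  proof -
    have "M \<ge> 2"
      using M assms(2) by (auto simp: doubleton_eq_iff)
    from \<open>M \<ge> 2\<close> cyclic_on_bij[OF f(1)] bspec[OF f(2)] show ?thesis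
    proof (rule choice_by_first_coordinate)
      fix P
      assume P: "seam_compatible ?N \<tau> P"
        and f_eq: "\<And>x. x \<in> cyl ?N M \<Longrightarrow> f x = cyl_step ?N \<tau> P M x"
      interpret cylinder_choice ?N \<tau> P
        using P by unfold_locales
      have "cyclic_on f (cyl ?N M) = cyclic_on (step M) (cyl ?N M)"
        by (rule cyclic_cong) (rule f_eq)
      with f(1) have cyc: "cyclic_on (step M) (cyl ?N M)"
        by (rule iffD1[rotated])
      have "pitch dvd 4 * n * fact (4 * gcd n m)"
        using assms(1,2) cyclic_on_imp_pitch_pos[OF \<open>M \<ge> 2\<close> cyc]
        by (intro pitch_dvd_added_columns) (simp_all add: \<tau>_def)
      then have "pitch dvd d"
        by (simp add: d_def \<open>g = _\<close>)
      then have shift: "cyclic_on (step (m + d)) (cyl ?N (m + d)) \<longleftrightarrow> cyclic_on (step m) (cyl ?N m)"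
        using assms(2) by (intro cyclic_on_add_dvd) simp_all
      have "M = m \<and> M' = m + d \<or> M = m + d \<and> M' = m"
        using M by (simp add: doubleton_eq_iff)
      then have "cyclic_on (step M') (cyl ?N M')"
        using cyc shift by (elim disjE conjE) simp_all
      then show ?thesis
        by (intro exI[of _ "step M'"]) (simp add: cyl_step_def)
    qed
  qed
  have d: "m + 4 * fact (4 * g) * n = m + d"
    by (simp add: d_def)
  have "seam_shift n (m + d) = \<tau>"
    using seam_shift_add[of m n] assms(2) by (simp add: d_def \<tau>_def)
  then have ham: "hamiltonian (torus_grid n M) \<longleftrightarrow> (\<exists>f. cyclic_on f (cyl ?N M) \<and>
      (\<forall>x\<in>cyl ?N M. f x = cyl_up ?N x \<or> f x = cyl_right ?N \<tau> M x))"
    if "M = m \<or> M = m + d" for M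
    using that hamiltonian_torus_grid_iff[of n M] assms(1,2) by (elim disjE) (simp_all add: \<tau>_def)
  show ?thesis
    unfolding d
  proof
    assume "hamiltonian (torus_grid n m)"
    then obtain f where f: "cyclic_on f (cyl ?N m)"
      "\<forall>x\<in>cyl ?N m. f x = cyl_up ?N x \<or> f x = cyl_right ?N \<tau> m x"
      unfolding ham[OF disjI1[OF refl]] by (elim exE conjE)
    show "hamiltonian (torus_grid n (m + d))"
      unfolding ham[OF disjI2[OF refl]] using f by (rule transfer) (rule refl)
  next
    assume "hamiltonian (torus_grid n (m + d))"
    then obtain f where f: "cyclic_on f (cyl ?N (m + d))"
      "\<forall>x\<in>cyl ?N (m + d). f x = cyl_up ?N x \<or> f x = cyl_right ?N \<tau> (m + d) x"
      unfolding ham[OF disjI2[OF refl]] by (elim exE conjE)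
    show "hamiltonian (torus_grid n m)"
      unfolding ham[OF disjI1[OF refl]] using f by (rule transfer) (rule insert_commute)
  qed
qed

end
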